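(* Let $\alpha=\{\alpha_n\}_{n\in\mathbb{Z}}$ be a bounded sequence of complex numbers and let $T=W_\alpha$ be the bilateral weighted shift on $\ell^2(\mathbb{Z})$ given by $W_\alpha e_n=\alpha_n e_{n+1}$ for $n\in\mathbb{Z}$. If $T$ is shifted hyperbolic, then the sequence of Aluthge iterates $\{\Delta^{(n)}(T)\}_{n\ge 1}$ does not converge in the operator norm.
   Context: $\{e_n\}_{n\in\mathbb{Z}}$ is the canonical orthonormal basis of the complex Hilbert space $\ell^2(\mathbb{Z})$. - A bounded linear operator $T$ on a Banach space $X$ is generalized hyperbolic if it is invertible (with bounded inverse) and there is a direct sum decomposition $X=M\oplus N$ into complementary closed subspaces such that (i) $T(M)\subset M$ and $T^{-1}(N)\subset N$; (ii) the restrictions $T|_M:M\to M$ and $T^{-1}|_N:N\to N$ have spectral radius $<1$. It is shifted hyperbolic if moreover $T^{-1}(M)\cap N\neq\{0\}$; equivalently, if it is generalized hyperbolic but not hyperbolic, where hyperbolic means that $\sigma(T)$ does not meet the unit circle $\{z\in\mathbb{C}:|z|=1\}$. - For a bounded operator $T$ on a Hilbert space let $T=U|T|$ be the polar decomposition, where $|T|=(T^*T)^{1/2}$ and $U$ is the unique partial isometry with $\ker U=\ker T=\ker|T|$. The Aluthge transform is $\Delta(T)=|T|^{1/2}U|T|^{1/2}$, and the Aluthge iterates are $\Delta^{(0)}(T)=T$, $\Delta^{(n)}(T)=\Delta(\Delta^{(n-1)}(T))$ for $n\ge1$. *)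

theory Defs
  imports "HOL-Analysis.Analysis"
begin

section \<open>Complex normed and inner product spaces\<close>

class complex_normed_vector = real_normed_vector +
  fixes scaleC :: "complex \<Rightarrow> 'a \<Rightarrow> 'a"  (infixr "*\<^sub>C" 75)
  assumes scaleC_add_right: "a *\<^sub>C (x + y) = a *\<^sub>C x + a *\<^sub>C y"
    and scaleC_add_left: "(a + b) *\<^sub>C x = a *\<^sub>C x + b *\<^sub>C x"
    and scaleC_scaleC: "a *\<^sub>C (b *\<^sub>C x) = (a * b) *\<^sub>C x"
    and scaleR_scaleC: "r *\<^sub>R x = complex_of_real r *\<^sub>C x"
    and norm_scaleC: "norm (a *\<^sub>C x) = cmod a * norm x"

text \<open>The inner product is linear in the first argument.\<close>

class complex_inner = complex_normed_vector +
  fixes cinner :: "'a \<Rightarrow> 'a \<Rightarrow> complex"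
  assumes cinner_commute: "cinner x y = cnj (cinner y x)"
    and cinner_add_left: "cinner (x + y) z = cinner x z + cinner y z"
    and cinner_scaleC_left: "cinner (a *\<^sub>C x) y = a * cinner x y"
    and cinner_self: "cinner x x = complex_of_real ((norm x)\<^sup>2)"

definition csubspace :: "'a::complex_normed_vector set \<Rightarrow> bool" where
  "csubspace M \<longleftrightarrow> 0 \<in> M \<and> (\<forall>x\<in>M. \<forall>y\<in>M. x + y \<in> M) \<and> (\<forall>a. \<forall>x\<in>M. a *\<^sub>C x \<in> M)"

text \<open>Bounded operators are elements of the library type of bounded real-linear maps, whose norm is
  the operator norm; complex linearity is imposed separately. Complex-linear maps form a closed
  subspace of that type, so convergence of a sequence of them has its usual meaning.\<close>

definition complex_linear ::
    "('a::complex_normed_vector \<Rightarrow>\<^sub>L 'b::complex_normed_vector) \<Rightarrow> bool" where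
  "complex_linear T \<longleftrightarrow> (\<forall>a x. T (a *\<^sub>C x) = a *\<^sub>C T x)"


section \<open>Generalized and shifted hyperbolicity\<close>

definition invertible_op :: "('a::complex_normed_vector \<Rightarrow>\<^sub>L 'a) \<Rightarrow> bool" where
  "invertible_op T \<longleftrightarrow> (\<exists>S. T o\<^sub>L S = id_blinfun \<and> S o\<^sub>L T = id_blinfun)"

definition inverse_op ::
    "('a::complex_normed_vector \<Rightarrow>\<^sub>L 'a) \<Rightarrow> ('a \<Rightarrow>\<^sub>L 'a)" where
  "inverse_op T = (THE S. T o\<^sub>L S = id_blinfun \<and> S o\<^sub>L T = id_blinfun)"

text \<open>The spectrum of the restriction of \<open>T\<close> to an invariant subspace \<open>M\<close>, as an operator
  \<open>M \<rightarrow> M\<close>: the complement of the set of \<open>z\<close> for which \<open>T - z\<close> maps \<open>M\<close> bijectively onto \<open>M\<close>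
  with bounded inverse.\<close>

definition spectrum_on ::
    "'a::complex_normed_vector set \<Rightarrow> ('a \<Rightarrow>\<^sub>L 'a) \<Rightarrow> complex set" where
  "spectrum_on M T = {z. \<not> (bij_betw (\<lambda>x. T x - z *\<^sub>C x) M M \<and>
      (\<exists>K. \<forall>x\<in>M. norm x \<le> K * norm (T x - z *\<^sub>C x)))}"

text \<open>The values lie in \<open>[0, \<infinity>]\<close>, so that the spectral radius of the operator on \<open>{0}\<close>, whose
  spectrum is empty, is \<open>0\<close>.\<close>

definition spectral_radius_on ::
    "'a::complex_normed_vector set \<Rightarrow> ('a \<Rightarrow>\<^sub>L 'a) \<Rightarrow> ennreal" where
  "spectral_radius_on M T = (SUP z\<in>spectrum_on M T. ennreal (cmod z))"

definition closed_complements :: "'a::complex_normed_vector set \<Rightarrow> 'a set \<Rightarrow> bool" where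
  "closed_complements M N \<longleftrightarrow>
     csubspace M \<and> csubspace N \<and> closed M \<and> closed N \<and>
     M \<inter> N = {0} \<and> (\<forall>x. \<exists>m\<in>M. \<exists>n\<in>N. x = m + n)"

definition gh_decomposition ::
    "('a::{complex_normed_vector, banach} \<Rightarrow>\<^sub>L 'a) \<Rightarrow> 'a set \<Rightarrow> 'a set \<Rightarrow> bool" where
  "gh_decomposition T M N \<longleftrightarrow>
     closed_complements M N \<and>
     blinfun_apply T ` M \<subseteq> M \<and> blinfun_apply (inverse_op T) ` N \<subseteq> N \<and>
     spectral_radius_on M T < 1 \<and> spectral_radius_on N (inverse_op T) < 1"

definition generalized_hyperbolic ::
    "('a::{complex_normed_vector, banach} \<Rightarrow>\<^sub>L 'a) \<Rightarrow> bool" where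
  "generalized_hyperbolic T \<longleftrightarrow>
     complex_linear T \<and> invertible_op T \<and> (\<exists>M N. gh_decomposition T M N)"

definition shifted_hyperbolic ::
    "('a::{complex_normed_vector, banach} \<Rightarrow>\<^sub>L 'a) \<Rightarrow> bool" where
  "shifted_hyperbolic T \<longleftrightarrow>
     complex_linear T \<and> invertible_op T \<and>
     (\<exists>M N. gh_decomposition T M N \<and> blinfun_apply (inverse_op T) ` M \<inter> N \<noteq> {0})"


section \<open>Polar decomposition and the Aluthge transform\<close>

definition adjoint_op ::
    "('a::{complex_inner, banach} \<Rightarrow>\<^sub>L 'a) \<Rightarrow> ('a \<Rightarrow>\<^sub>L 'a)" where
  "adjoint_op T = (THE S :: 'a \<Rightarrow>\<^sub>L 'a. \<forall>x y. cinner (T x) y = cinner x (S y))"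

definition positive_op :: "('a::{complex_inner, banach} \<Rightarrow>\<^sub>L 'a) \<Rightarrow> bool" where
  "positive_op A \<longleftrightarrow>
     complex_linear A \<and> (\<forall>x. cinner (A x) x \<in> \<real> \<and> 0 \<le> Re (cinner (A x) x))"

definition sqrt_op :: "('a::{complex_inner, banach} \<Rightarrow>\<^sub>L 'a) \<Rightarrow> ('a \<Rightarrow>\<^sub>L 'a)" where
  "sqrt_op A = (THE B. positive_op B \<and> B o\<^sub>L B = A)"

definition abs_op :: "('a::{complex_inner, banach} \<Rightarrow>\<^sub>L 'a) \<Rightarrow> ('a \<Rightarrow>\<^sub>L 'a)" where
  "abs_op T = sqrt_op (adjoint_op T o\<^sub>L T)"

definition kernel_op :: "('a::complex_normed_vector \<Rightarrow>\<^sub>L 'a) \<Rightarrow> 'a set" where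
  "kernel_op T = {x. T x = 0}"

definition partial_isometry :: "('a::{complex_inner, banach} \<Rightarrow>\<^sub>L 'a) \<Rightarrow> bool" where
  "partial_isometry U \<longleftrightarrow>
     complex_linear U \<and>
     (\<forall>x. (\<forall>y\<in>kernel_op U. cinner x y = 0) \<longrightarrow> norm (U x) = norm x)"

definition polar_factor :: "('a::{complex_inner, banach} \<Rightarrow>\<^sub>L 'a) \<Rightarrow> ('a \<Rightarrow>\<^sub>L 'a)" where
  "polar_factor T =
     (THE U. partial_isometry U \<and> kernel_op U = kernel_op T \<and> T = U o\<^sub>L abs_op T)"

definition aluthge :: "('a::{complex_inner, banach} \<Rightarrow>\<^sub>L 'a) \<Rightarrow> ('a \<Rightarrow>\<^sub>L 'a)" where
  "aluthge T = sqrt_op (abs_op T) o\<^sub>L polar_factor T o\<^sub>L sqrt_op (abs_op T)"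

definition aluthge_iterate ::
    "nat \<Rightarrow> ('a::{complex_inner, banach} \<Rightarrow>\<^sub>L 'a) \<Rightarrow> ('a \<Rightarrow>\<^sub>L 'a)" where
  "aluthge_iterate n T = (aluthge ^^ n) T"


section \<open>The Hilbert space of square-summable families\<close>

typedef 'i ell2 = "{f :: 'i \<Rightarrow> complex. (\<lambda>i. (cmod (f i))\<^sup>2) summable_on UNIV}"
  morphisms ell2_nth Abs_ell2
  by (rule exI[of _ "\<lambda>_. 0"]) simp

lemma ell2_nth_summable: "(\<lambda>i. (cmod (ell2_nth x i))\<^sup>2) summable_on UNIV"
  using ell2_nth[of x] by simp

lemma ell2_eqI: "(\<And>i. ell2_nth x i = ell2_nth y i) \<Longrightarrow> x = y"
  by (metis ell2_nth_inject ext)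

lemma ell2_nth_Abs:
  "(\<lambda>i. (cmod (f i))\<^sup>2) summable_on UNIV \<Longrightarrow> ell2_nth (Abs_ell2 f) i = f i"
  by (simp add: Abs_ell2_inverse)

lemma square_summable_add:
  assumes "(\<lambda>i. (cmod (f i))\<^sup>2) summable_on A" "(\<lambda>i. (cmod (g i))\<^sup>2) summable_on A"
  shows "(\<lambda>i. (cmod (f i + g i))\<^sup>2) summable_on A"
proof (rule summable_on_comparison_test)
  show "(\<lambda>i. 2 * (cmod (f i))\<^sup>2 + 2 * (cmod (g i))\<^sup>2) summable_on A"
    by (intro summable_on_add summable_on_cmult_right assms)
  show "(cmod (f i + g i))\<^sup>2 \<le> 2 * (cmod (f i))\<^sup>2 + 2 * (cmod (g i))\<^sup>2" for i
  proof -
    have "(cmod (f i + g i))\<^sup>2 \<le> (cmod (f i) + cmod (g i))\<^sup>2"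
      by (intro power_mono norm_triangle_ineq) simp
    also have "\<dots> \<le> 2 * (cmod (f i))\<^sup>2 + 2 * (cmod (g i))\<^sup>2"
      using sum_squares_bound[of "cmod (f i)" "cmod (g i)"] by (simp add: power2_sum)
    finally show ?thesis .
  qed
qed simp

lemma square_summable_cmult:
  assumes "(\<lambda>i. (cmod (f i))\<^sup>2) summable_on A"
  shows "(\<lambda>i. (cmod (c * f i))\<^sup>2) summable_on A"
  using summable_on_cmult_right[OF assms, of "(cmod c)\<^sup>2"]
  by (simp add: norm_mult power_mult_distrib)

lemma square_summable_mult:
  assumes "(\<lambda>i. (cmod (f i))\<^sup>2) summable_on A" "(\<lambda>i. (cmod (g i))\<^sup>2) summable_on A"
  shows "(\<lambda>i. f i * cnj (g i)) summable_on A"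
proof (rule abs_summable_summable, rule summable_on_comparison_test)
  show "(\<lambda>i. (cmod (f i))\<^sup>2 + (cmod (g i))\<^sup>2) summable_on A"
    by (intro summable_on_add assms)
  show "norm (f i * cnj (g i)) \<le> (cmod (f i))\<^sup>2 + (cmod (g i))\<^sup>2" for i
  proof -
    have "0 \<le> cmod (f i) * cmod (g i)"
      by simp
    moreover have "2 * (cmod (f i) * cmod (g i)) \<le> (cmod (f i))\<^sup>2 + (cmod (g i))\<^sup>2"
      using sum_squares_bound[of "cmod (f i)" "cmod (g i)"] by (simp add: mult.assoc)
    ultimately show ?thesis
      unfolding norm_mult complex_mod_cnj by linarith
  qed
qed simp

instantiation ell2 :: (type) real_inner
begin

definition zero_ell2 :: "'a ell2" where "0 = Abs_ell2 (\<lambda>_. 0)"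
definition plus_ell2 :: "'a ell2 \<Rightarrow> 'a ell2 \<Rightarrow> 'a ell2" where
  "x + y = Abs_ell2 (\<lambda>i. ell2_nth x i + ell2_nth y i)"
definition uminus_ell2 :: "'a ell2 \<Rightarrow> 'a ell2" where
  "- x = Abs_ell2 (\<lambda>i. - ell2_nth x i)"
definition minus_ell2 :: "'a ell2 \<Rightarrow> 'a ell2 \<Rightarrow> 'a ell2" where
  "x - y = x + - (y :: 'a ell2)"
definition scaleR_ell2 :: "real \<Rightarrow> 'a ell2 \<Rightarrow> 'a ell2" where
  "r *\<^sub>R x = Abs_ell2 (\<lambda>i. r *\<^sub>R ell2_nth x i)"
definition inner_ell2 :: "'a ell2 \<Rightarrow> 'a ell2 \<Rightarrow> real" where
  "inner x y = Re (\<Sum>\<^sub>\<infinity>i. ell2_nth x i * cnj (ell2_nth y i))"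
definition norm_ell2 :: "'a ell2 \<Rightarrow> real" where
  "norm x = sqrt (\<Sum>\<^sub>\<infinity>i. (cmod (ell2_nth x i))\<^sup>2)"
definition sgn_ell2_def: "sgn (x :: 'a ell2) = inverse (norm x) *\<^sub>R x"
definition dist_ell2_def: "dist (x :: 'a ell2) y = norm (x - y)"
definition uniformity_ell2_def [code del]:
  "(uniformity :: ('a ell2 \<times> 'a ell2) filter) = (INF e\<in>{0<..}. principal {(x, y). dist x y < e})"
definition open_ell2_def [code del]:
  "open (U :: 'a ell2 set) \<longleftrightarrow> (\<forall>x\<in>U. \<forall>\<^sub>F (x', y) in uniformity. x' = x \<longrightarrow> y \<in> U)"

lemma ell2_nth_zero [simp]: "ell2_nth 0 i = 0"
  by (simp add: zero_ell2_def ell2_nth_Abs)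

lemma ell2_nth_add [simp]: "ell2_nth (x + y) i = ell2_nth x i + ell2_nth y i"
  by (simp add: plus_ell2_def ell2_nth_Abs square_summable_add ell2_nth_summable)

lemma ell2_nth_uminus [simp]: "ell2_nth (- x) i = - ell2_nth x i"
  by (simp add: uminus_ell2_def ell2_nth_Abs ell2_nth_summable)

lemma ell2_nth_diff [simp]: "ell2_nth (x - y) i = ell2_nth x i - ell2_nth y i"
  by (simp add: minus_ell2_def)

lemma ell2_nth_scaleR [simp]: "ell2_nth (r *\<^sub>R x) i = r *\<^sub>R ell2_nth x i"
  using square_summable_cmult[OF ell2_nth_summable[of x], of "complex_of_real r"]
  by (simp add: scaleR_ell2_def ell2_nth_Abs scaleR_conv_of_real)

lemma ell2_self_eq:
  "(\<Sum>\<^sub>\<infinity>i. ell2_nth x i * cnj (ell2_nth x i)) =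
     complex_of_real (\<Sum>\<^sub>\<infinity>i. (cmod (ell2_nth x i))\<^sup>2)"
proof -
  have "ell2_nth x i * cnj (ell2_nth x i) = complex_of_real ((cmod (ell2_nth x i))\<^sup>2)" for i
    by (rule complex_norm_square[symmetric])
  then show ?thesis
    using has_sum_of_real[OF has_sum_infsum[OF ell2_nth_summable[of x]], where ?'a = complex]
    by (simp only: infsumI)
qed

instance
proof
  fix x y z :: "'a ell2" and a b :: real
  have mult: "(\<lambda>i. ell2_nth u i * cnj (ell2_nth v i)) summable_on UNIV" for u v :: "'a ell2"
    by (intro square_summable_mult ell2_nth_summable)
  have nonneg: "0 \<le> (\<Sum>\<^sub>\<infinity>i. (cmod (ell2_nth x i))\<^sup>2)"
    by (intro infsum_nonneg) simp
  show "x + y + z = x + (y + z)" "x + y = y + x" "0 + x = x" "- x + x = 0" "x - y = x + - y"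
    "a *\<^sub>R (x + y) = a *\<^sub>R x + a *\<^sub>R y" "(a + b) *\<^sub>R x = a *\<^sub>R x + b *\<^sub>R x"
    "a *\<^sub>R b *\<^sub>R x = (a * b) *\<^sub>R x" "1 *\<^sub>R x = x"
    by (rule ell2_eqI; simp add: algebra_simps)+
  show "sgn x = inverse (norm x) *\<^sub>R x" "dist x y = norm (x - y)"
    by (fact sgn_ell2_def dist_ell2_def)+
  show "(uniformity :: ('a ell2 \<times> 'a ell2) filter) =
      (INF e\<in>{0<..}. principal {(x, y). dist x y < e})"
    by (fact uniformity_ell2_def)
  show "open U \<longleftrightarrow> (\<forall>x\<in>U. \<forall>\<^sub>F (x', y) in uniformity. x' = x \<longrightarrow> y \<in> U)" for U :: "'a ell2 set"
    by (fact open_ell2_def)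
  have "(\<Sum>\<^sub>\<infinity>i. ell2_nth x i * cnj (ell2_nth y i)) =
      cnj (\<Sum>\<^sub>\<infinity>i. ell2_nth y i * cnj (ell2_nth x i))"
    by (simp add: infsum_cnj[symmetric] mult.commute del: infsum_cnj)
  then show "inner x y = inner y x"
    by (simp add: inner_ell2_def)
  show "inner (x + y) z = inner x z + inner y z"
    by (simp add: inner_ell2_def distrib_right infsum_add mult)
  show "inner (a *\<^sub>R x) y = a * inner x y"
    by (simp add: inner_ell2_def infsum_cmult_right' scaleR_conv_of_real mult.assoc)
  show "0 \<le> inner x x"
    using nonneg by (simp add: inner_ell2_def ell2_self_eq)
  show "inner x x = 0 \<longleftrightarrow> x = 0"
  proof
    assume "inner x x = 0"
    then have "(\<Sum>\<^sub>\<infinity>i. (cmod (ell2_nth x i))\<^sup>2) \<le> 0"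
      by (simp add: inner_ell2_def ell2_self_eq)
    from nonneg_infsum_le_0D[OF this ell2_nth_summable] show "x = 0"
      by (intro ell2_eqI) simp
  qed (simp add: inner_ell2_def)
  show "norm x = sqrt (inner x x)"
    by (simp add: inner_ell2_def norm_ell2_def ell2_self_eq)
qed

end

instantiation ell2 :: (type) complex_inner
begin

definition scaleC_ell2 :: "complex \<Rightarrow> 'a ell2 \<Rightarrow> 'a ell2" where
  "a *\<^sub>C x = Abs_ell2 (\<lambda>i. a * ell2_nth x i)"
definition cinner_ell2 :: "'a ell2 \<Rightarrow> 'a ell2 \<Rightarrow> complex" where
  "cinner x y = (\<Sum>\<^sub>\<infinity>i. ell2_nth x i * cnj (ell2_nth y i))"

lemma ell2_nth_scaleC [simp]: "ell2_nth (a *\<^sub>C x) i = a * ell2_nth x i"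
  by (simp add: scaleC_ell2_def ell2_nth_Abs square_summable_cmult ell2_nth_summable)

lemma norm_ell2_square: "(norm x)\<^sup>2 = (\<Sum>\<^sub>\<infinity>i. (cmod (ell2_nth x i))\<^sup>2)"
  by (simp add: norm_ell2_def infsum_nonneg)

instance
proof
  fix x y z :: "'a ell2" and a b :: complex and r :: real
  have mult: "(\<lambda>i. ell2_nth u i * cnj (ell2_nth v i)) summable_on UNIV" for u v :: "'a ell2"
    by (intro square_summable_mult ell2_nth_summable)
  show "a *\<^sub>C (x + y) = a *\<^sub>C x + a *\<^sub>C y" "(a + b) *\<^sub>C x = a *\<^sub>C x + b *\<^sub>C x"
    "a *\<^sub>C b *\<^sub>C x = (a * b) *\<^sub>C x" "r *\<^sub>R x = complex_of_real r *\<^sub>C x"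
    by (rule ell2_eqI; simp add: algebra_simps scaleR_conv_of_real)+
  show "norm (a *\<^sub>C x) = cmod a * norm x"
    by (simp add: norm_ell2_def norm_mult power_mult_distrib infsum_cmult_right' real_sqrt_mult)
  show "cinner x y = cnj (cinner y x)"
    by (simp add: cinner_ell2_def infsum_cnj[symmetric] mult.commute del: infsum_cnj)
  show "cinner (x + y) z = cinner x z + cinner y z"
    by (simp add: cinner_ell2_def distrib_right infsum_add mult)
  show "cinner (a *\<^sub>C x) y = a * cinner x y"
    by (simp add: cinner_ell2_def infsum_cmult_right' mult.assoc)
  show "cinner x x = complex_of_real ((norm x)\<^sup>2)"
    by (simp add: cinner_ell2_def ell2_self_eq norm_ell2_square del: of_real_power)
qed

end

lemma ell2_sum_le_norm: "finite F \<Longrightarrow> (\<Sum>i\<in>F. (cmod (ell2_nth x i))\<^sup>2) \<le> (norm x)\<^sup>2"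
  unfolding norm_ell2_square by (intro finite_sum_le_infsum ell2_nth_summable) auto

lemma ell2_nth_le_norm: "cmod (ell2_nth x i) \<le> norm x"
  using ell2_sum_le_norm[of "{i}" x] by (simp add: power2_le_iff_abs_le)

lemma square_summableI:
  assumes "\<And>F. finite F \<Longrightarrow> (\<Sum>i\<in>F. (cmod (f i))\<^sup>2) \<le> C"
  shows "(\<lambda>i. (cmod (f i))\<^sup>2) summable_on UNIV"
  by (rule nonneg_bounded_partial_sums_imp_summable_on[where C = C])
     (auto intro!: eventually_finite_subsets_at_top_weakI assms)

lemma norm_ell2_leI:
  assumes "\<And>F. finite F \<Longrightarrow> (\<Sum>i\<in>F. (cmod (ell2_nth x i))\<^sup>2) \<le> C\<^sup>2" "0 \<le> C"
  shows "norm x \<le> C"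
proof -
  have "(norm x)\<^sup>2 \<le> C\<^sup>2"
    unfolding norm_ell2_square by (intro infsum_le_finite_sums ell2_nth_summable assms)
  then show ?thesis
    using assms(2) by (rule power2_le_imp_le)
qed

instance ell2 :: (type) banach
proof
  fix X :: "nat \<Rightarrow> 'a ell2"
  assume X: "Cauchy X"
  have "Cauchy (\<lambda>n. ell2_nth (X n) i)" for i
  proof (rule CauchyI)
    fix e :: real assume "0 < e"
    then obtain M where "\<forall>m\<ge>M. \<forall>n\<ge>M. norm (X m - X n) < e"
      using CauchyD[OF X] by blast
    then show "\<exists>M. \<forall>m\<ge>M. \<forall>n\<ge>M. norm (ell2_nth (X m) i - ell2_nth (X n) i) < e"
      by (metis ell2_nth_diff ell2_nth_le_norm le_less_trans)
  qed
  then have "\<forall>i. \<exists>l. (\<lambda>n. ell2_nth (X n) i) \<longlonglongrightarrow> l"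
    using Cauchy_convergent convergent_def by blast
  then obtain l where l: "\<And>i. (\<lambda>n. ell2_nth (X n) i) \<longlonglongrightarrow> l i"
    by metis
  have tail: "(\<Sum>i\<in>F. (cmod (ell2_nth (X m) i - l i))\<^sup>2) \<le> e\<^sup>2"
    if "finite F" and M: "\<forall>m\<ge>M. \<forall>n\<ge>M. norm (X m - X n) < e" and "m \<ge> M" for F M m e
  proof (rule LIMSEQ_le_const2)
    show "(\<lambda>n. \<Sum>i\<in>F. (cmod (ell2_nth (X m) i - ell2_nth (X n) i))\<^sup>2)
        \<longlonglongrightarrow> (\<Sum>i\<in>F. (cmod (ell2_nth (X m) i - l i))\<^sup>2)"
      by (intro tendsto_intros l)
    have "(\<Sum>i\<in>F. (cmod (ell2_nth (X m) i - ell2_nth (X n) i))\<^sup>2) \<le> e\<^sup>2" if "n \<ge> M" for n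
    proof -
      have "(\<Sum>i\<in>F. (cmod (ell2_nth (X m) i - ell2_nth (X n) i))\<^sup>2) \<le> (norm (X m - X n))\<^sup>2"
        using ell2_sum_le_norm[OF \<open>finite F\<close>, of "X m - X n"] by simp
      also have "\<dots> \<le> e\<^sup>2"
        using M \<open>m \<ge> M\<close> that by (intro power_mono) (auto intro: less_imp_le)
      finally show ?thesis .
    qed
    then show "\<exists>N. \<forall>n\<ge>N. (\<Sum>i\<in>F. (cmod (ell2_nth (X m) i - ell2_nth (X n) i))\<^sup>2) \<le> e\<^sup>2"
      by blast
  qed
  obtain M1 where M1: "\<forall>m\<ge>M1. \<forall>n\<ge>M1. norm (X m - X n) < 1"
    using CauchyD[OF X, of 1] by auto
  have "(\<lambda>i. (cmod (ell2_nth (X M1) i - l i))\<^sup>2) summable_on UNIV"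
    by (rule square_summableI[where C = "1\<^sup>2"]) (rule tail[OF _ M1], auto)
  from square_summable_add[OF square_summable_cmult[OF this, of "-1"] ell2_nth_summable[of "X M1"]]
  have "(\<lambda>i. (cmod (l i))\<^sup>2) summable_on UNIV"
    by simp
  then have L: "ell2_nth (Abs_ell2 l) i = l i" for i
    by (rule ell2_nth_Abs)
  have "X \<longlonglongrightarrow> Abs_ell2 l"
  proof (rule LIMSEQ_I)
    fix r :: real assume "0 < r"
    then obtain M where M: "\<forall>m\<ge>M. \<forall>n\<ge>M. norm (X m - X n) < r / 2"
      using CauchyD[OF X, of "r / 2"] by auto
    have "norm (X m - Abs_ell2 l) \<le> r / 2" if "m \<ge> M" for m
      using tail[OF _ M that] \<open>0 < r\<close> by (intro norm_ell2_leI) (auto simp: L)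
    then show "\<exists>no. \<forall>n\<ge>no. norm (X n - Abs_ell2 l) < r"
      using \<open>0 < r\<close> by (intro exI[of _ M]) fastforce
  qed
  then show "convergent X"
    by (rule convergentI)
qed


section \<open>Bilateral weighted shifts\<close>

definition ell2_basis :: "'i \<Rightarrow> 'i ell2" where
  "ell2_basis n = Abs_ell2 (\<lambda>i. if i = n then 1 else 0)"

text \<open>In coordinates, \<open>(W\<^sub>\<alpha> x)\<^sub>i = \<alpha>\<^sub>i\<^sub>-\<^sub>1 x\<^sub>i\<^sub>-\<^sub>1\<close>; only meaningful for bounded \<open>\<alpha>\<close>.\<close>

definition weighted_shift :: "(int \<Rightarrow> complex) \<Rightarrow> int ell2 \<Rightarrow>\<^sub>L int ell2" where
  "weighted_shift \<alpha> = Blinfun (\<lambda>x. Abs_ell2 (\<lambda>i. \<alpha> (i - 1) * ell2_nth x (i - 1)))"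

lemma ell2_nth_basis [simp]: "ell2_nth (ell2_basis n) i = (if i = n then 1 else 0)"
proof -
  have "(\<lambda>i. (cmod (if i = n then 1 else 0))\<^sup>2) summable_on UNIV"
    by (rule finite_nonzero_values_imp_summable_on) (simp add: if_distrib cong: if_cong)
  then show ?thesis
    by (simp add: ell2_basis_def ell2_nth_Abs)
qed

lemma ell2_nth_weighted_shift:
  assumes "bounded (range \<alpha>)"
  shows "ell2_nth (weighted_shift \<alpha> x) i = \<alpha> (i - 1) * ell2_nth x (i - 1)"
proof -
  obtain K where K: "\<And>i. cmod (\<alpha> i) \<le> K"
    using assms by (auto simp: bounded_iff)
  then have "0 \<le> K"
    using norm_ge_zero order_trans by blast
  have bound: "(\<Sum>i\<in>F. (cmod (\<alpha> (i - 1) * ell2_nth x (i - 1)))\<^sup>2) \<le> (norm x * K)\<^sup>2"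
    if "finite F" for F and x :: "int ell2"
  proof -
    have "(\<Sum>i\<in>F. (cmod (\<alpha> (i - 1) * ell2_nth x (i - 1)))\<^sup>2)
        \<le> (\<Sum>i\<in>F. K\<^sup>2 * (cmod (ell2_nth x (i - 1)))\<^sup>2)"
      by (intro sum_mono) (auto simp: norm_mult power_mult_distrib intro!: mult_right_mono power_mono K)
    also have "\<dots> = K\<^sup>2 * (\<Sum>i\<in>(\<lambda>i. i - 1) ` F. (cmod (ell2_nth x i))\<^sup>2)"
      by (simp add: sum_distrib_left sum.reindex inj_on_def)
    also have "\<dots> \<le> K\<^sup>2 * (norm x)\<^sup>2"
      using that by (intro mult_left_mono ell2_sum_le_norm) auto
    finally show ?thesis
      by (simp add: power_mult_distrib mult.commute)
  qed
  define W where "W = (\<lambda>x. Abs_ell2 (\<lambda>i. \<alpha> (i - 1) * ell2_nth x (i - 1)))"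
  have W: "ell2_nth (W x) i = \<alpha> (i - 1) * ell2_nth x (i - 1)" for x i
    unfolding W_def by (rule ell2_nth_Abs, rule square_summableI, rule bound)
  have "bounded_linear W"
  proof (rule bounded_linear_intro)
    show "W (x + y) = W x + W y" "W (r *\<^sub>R x) = r *\<^sub>R W x" for x y r
      by (rule ell2_eqI; simp add: W algebra_simps)+
    show "norm (W x) \<le> norm x * K" for x
      using bound[of _ x] \<open>0 \<le> K\<close> by (intro norm_ell2_leI) (auto simp: W)
  qed
  then have "blinfun_apply (weighted_shift \<alpha>) = W"
    unfolding weighted_shift_def W_def by (rule bounded_linear_Blinfun_apply)
  then show ?thesis
    by (simp add: W)
qed

lemma complex_linear_weighted_shift:
  "bounded (range \<alpha>) \<Longrightarrow> complex_linear (weighted_shift \<alpha>)"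
  unfolding complex_linear_def by (auto intro!: ell2_eqI simp: ell2_nth_weighted_shift)

lemma weighted_shift_basis:
  "bounded (range \<alpha>) \<Longrightarrow> weighted_shift \<alpha> (ell2_basis n) = \<alpha> n *\<^sub>C ell2_basis (n + 1)"
  by (rule ell2_eqI) (auto simp: ell2_nth_weighted_shift)

end

theory Submission
  imports Defs
begin

text \<open>
  For a shifted hyperbolic \<open>T\<close>, a nonzero \<open>n \<in> N\<close> with \<open>T n \<in> M\<close> yields eigenvectors of \<open>T\<close> for all
  \<open>z\<close> in an annulus around the unit circle: solve \<open>(T - z) a = z T n\<close> in \<open>M\<close> and
  \<open>(T - z) b = - z T n\<close> in \<open>N\<close> and add. An eigenvector \<open>x\<close> of \<open>W\<^sub>\<alpha>\<close> satisfies
  \<open>ln |x\<^sub>i\<^sub>+\<^sub>1| - ln |x\<^sub>i| = ln |\<alpha>\<^sub>i| - ln |z|\<close>, and \<open>ln |x\<^sub>i|\<close> is bounded above.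

  The Aluthge transform keeps the phases of the weights and replaces \<open>b\<^sub>i = ln |\<alpha>\<^sub>i|\<close> by
  \<open>(b\<^sub>i + b\<^sub>i\<^sub>+\<^sub>1) / 2\<close>. If the iterates converge in norm, then the averaged sequences converge
  uniformly, necessarily to a constant \<open>\<beta>\<close>. Averaging \<open>ln |x\<^sub>i|\<close> alongside \<open>b\<close> preserves both the
  difference equation and the upper bound, and a sequence over \<open>\<int>\<close> that is bounded above cannot have
  all its increments close to \<open>\<beta> - ln |z| \<noteq> 0\<close>. So \<open>\<beta> = ln |z|\<close> for different values of \<open>|z|\<close>.
\<close>

section \<open>Eigenvectors of shifted hyperbolic operators\<close>

lemma scaleC_one [simp]: "1 *\<^sub>C x = (x :: 'a::complex_normed_vector)"
  using scaleR_scaleC[of 1 x] by simp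

lemma scaleC_zero_left [simp]: "0 *\<^sub>C x = (0 :: 'a::complex_normed_vector)"
  using scaleR_scaleC[of 0 x] by simp

lemma scaleC_zero_right [simp]: "a *\<^sub>C (0 :: 'a::complex_normed_vector) = 0"
  using scaleC_add_right[of a 0 0] by simp

lemma scaleC_minus_right: "a *\<^sub>C (- x) = - (a *\<^sub>C (x :: 'a::complex_normed_vector))"
  using scaleC_add_right[of a x "- x"] by (simp add: eq_neg_iff_add_eq_0 add.commute)

lemma scaleC_diff_right: "a *\<^sub>C (x - y) = a *\<^sub>C x - a *\<^sub>C (y :: 'a::complex_normed_vector)"
  using scaleC_add_right[of a x "- y"] by (simp add: scaleC_minus_right)

lemma inverse_op_eqI:
  assumes "T o\<^sub>L S = id_blinfun" "S o\<^sub>L T = id_blinfun"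
  shows "inverse_op T = S"
  unfolding inverse_op_def
proof (rule the_equality)
  fix S' assume S': "T o\<^sub>L S' = id_blinfun \<and> S' o\<^sub>L T = id_blinfun"
  show "S' = S"
  proof (rule blinfun_eqI)
    fix x
    have "S' x = S' (T (S x))"
      using arg_cong[OF assms(1), of "\<lambda>A. blinfun_apply A x"] by simp
    also have "\<dots> = S x"
      using S' by (metis blinfun_apply_blinfun_compose id_blinfun.rep_eq id_apply)
    finally show "S' x = S x" .
  qed
qed (use assms in blast)

lemma inverse_op_apply:
  assumes "invertible_op T"
  shows "T (inverse_op T x) = x" "inverse_op T (T x) = x"
proof -
  obtain S where S: "T o\<^sub>L S = id_blinfun" "S o\<^sub>L T = id_blinfun"
    using assms unfolding invertible_op_def by blast
  show "T (inverse_op T x) = x"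
    using arg_cong[OF S(1), of "\<lambda>A. blinfun_apply A x"] by (simp add: inverse_op_eqI[OF S])
  show "inverse_op T (T x) = x"
    using arg_cong[OF S(2), of "\<lambda>A. blinfun_apply A x"] by (simp add: inverse_op_eqI[OF S])
qed

text \<open>The spectral radius is a supremum of moduli over the spectrum, so \<open>z\<close> lies
  outside the spectrum and \<open>T - z\<close> maps \<open>M\<close> onto \<open>M\<close>.\<close>

lemma spectral_radius_on_less_solve:
  assumes "spectral_radius_on M T < ennreal (cmod z)" "y \<in> M"
  obtains x where "x \<in> M" "T x - z *\<^sub>C x = y"
proof -
  have "z \<notin> spectrum_on M T"
  proof
    assume "z \<in> spectrum_on M T"
    then have "ennreal (cmod z) \<le> spectral_radius_on M T"
      unfolding spectral_radius_on_def by (rule SUP_upper)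
    with assms(1) show False
      by simp
  qed
  then have "bij_betw (\<lambda>x. T x - z *\<^sub>C x) M M"
    unfolding spectrum_on_def by blast
  then have "y \<in> (\<lambda>x. T x - z *\<^sub>C x) ` M"
    using assms(2) by (simp add: bij_betw_def)
  then obtain x where "x \<in> M" "T x - z *\<^sub>C x = y"
    by blast
  then show ?thesis
    by (rule that)
qed

text \<open>The vector \<open>n\<close> links the two subspaces: the resolvent equations solved
  separately in \<open>M\<close> and in \<open>N\<close> have opposite right-hand sides, so the sum
  of the solutions is annihilated by \<open>T - z\<close>.\<close>

lemma gh_decomposition_eigenvector:
  assumes T: "complex_linear T" "invertible_op T" and gh: "gh_decomposition T M N"
    and n: "n \<in> N" "T n \<in> M" "n \<noteq> 0"
    and z: "spectral_radius_on M T < ennreal (cmod z)"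
      "spectral_radius_on N (inverse_op T) < ennreal (cmod (inverse z))" "z \<noteq> 0"
  obtains x where "x \<noteq> 0" "T x = z *\<^sub>C x"
proof -
  have MN: "csubspace M" "csubspace N" "M \<inter> N = {0}"
    using gh unfolding gh_decomposition_def closed_complements_def by blast+
  have "z *\<^sub>C T n \<in> M"
    using MN(1) n(2) unfolding csubspace_def by blast
  then obtain a where a: "a \<in> M" "T a - z *\<^sub>C a = z *\<^sub>C T n"
    using spectral_radius_on_less_solve[OF z(1)] by blast
  \<comment> \<open>On \<open>N\<close> it is the inverse of \<open>T\<close> whose spectrum is
    controlled, so \<open>(T - z) b = - z T n\<close> is posed as
    \<open>(inverse_op T - inverse z) b = n\<close>; applying \<open>- z T\<close> recovers
    it.\<close>
  obtain b where b: "b \<in> N" "inverse_op T b - inverse z *\<^sub>C b = n"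
    using spectral_radius_on_less_solve[OF z(2) n(1)] by blast
  have "T n = b - inverse z *\<^sub>C T b"
    unfolding b(2)[symmetric] using T(1)
    by (simp add: blinfun.diff_right inverse_op_apply[OF T(2)] complex_linear_def)
  then have zTn: "z *\<^sub>C T n = z *\<^sub>C b - T b"
    using z(3) by (simp add: scaleC_diff_right scaleC_scaleC)
  show ?thesis
  proof
    show "T (a + b) = z *\<^sub>C (a + b)"
      using a(2) zTn by (simp add: blinfun.add_right scaleC_add_right algebra_simps)
    show "a + b \<noteq> 0"
    \<comment> \<open>If the sum vanished, \<open>b\<close> would lie in both \<open>M\<close> and
      \<open>N\<close>, hence be zero, and its defining equation would give
      \<open>n = 0\<close>.\<close>
    proof
      assume "a + b = 0"
      then have "b = (- 1) *\<^sub>C a"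
        using scaleR_scaleC[of "- 1" a] by (simp add: add_eq_0_iff)
      then have "b \<in> M"
        using MN(1) a(1) unfolding csubspace_def by blast
      then have "b = 0"
        using MN(3) b(1) by blast
      then have "n = 0"
        using b(2) by (simp add: blinfun.zero_right)
      with n(3) show False ..
    qed
  qed
qed

text \<open>Two eigenvalues of different modulus suffice later; \<open>1\<close> and a slightly
  larger real number both lie in the annulus.\<close>

lemma shifted_hyperbolic_eigenvectors:
  assumes "shifted_hyperbolic T"
  obtains R x y where "R > 1" "x \<noteq> 0" "T x = x" "y \<noteq> 0" "T y = complex_of_real R *\<^sub>C y"
proof -
  obtain M N where T: "complex_linear T" "invertible_op T" and gh: "gh_decomposition T M N"
    and ne: "blinfun_apply (inverse_op T) ` M \<inter> N \<noteq> {0}"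
    using assms unfolding shifted_hyperbolic_def by blast
  have "0 \<in> M" "0 \<in> N" and rM: "spectral_radius_on M T < 1"
    and rN: "spectral_radius_on N (inverse_op T) < 1"
    using gh unfolding gh_decomposition_def closed_complements_def csubspace_def by blast+
  then have "0 \<in> blinfun_apply (inverse_op T) ` M \<inter> N"
    by (force simp: blinfun.zero_right intro: rev_image_eqI[of 0])
  with ne obtain n where "n \<in> blinfun_apply (inverse_op T) ` M" "n \<in> N" "n \<noteq> 0"
    by blast
  then have n: "n \<in> N" "T n \<in> M" "n \<noteq> 0"
    by (auto simp: inverse_op_apply[OF T(2)])
  \<comment> \<open>The second eigenvalue is \<open>1 / s\<close>: its reciprocal still exceeds the
    spectral radius on \<open>N\<close>, while \<open>1 / s > 1\<close> exceeds the one on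
    \<open>M\<close>.\<close>
  obtain s where s: "spectral_radius_on N (inverse_op T) < s" "s < 1"
    using dense[OF rN] by blast
  have "0 < s"
    using s(1) by (rule le_less_trans[OF zero_le])
  obtain w where w: "s = ennreal w" "0 \<le> w"
    using s(2) by (cases s) auto
  with s(2) \<open>0 < s\<close> have w01: "0 < w" "w < 1"
    by (auto simp: ennreal_less_one_iff)
  have "1 \<le> ennreal (1 / w)"
    using w01 by simp
  with rM have rM': "spectral_radius_on M T < ennreal (1 / w)"
    by (rule less_le_trans)
  obtain x where x: "x \<noteq> 0" "T x = 1 *\<^sub>C x"
    by (rule gh_decomposition_eigenvector[OF T gh n, of 1]) (use rM rN in auto)
  obtain y where y: "y \<noteq> 0" "T y = complex_of_real (1 / w) *\<^sub>C y"
    by (rule gh_decomposition_eigenvector[OF T gh n, of "complex_of_real (1 / w)"])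
      (use rM' s(1) w w01 in \<open>auto simp: norm_divide norm_inverse\<close>)
  show ?thesis
    by (rule that[of "1 / w" x y]) (use w01 x y in auto)
qed

section \<open>Averaging over neighbours\<close>

text \<open>The Aluthge transform replaces the moduli of neighbouring weights by their geometric
  mean; this is its effect on their logarithms.\<close>

definition neighbour_avg :: "(int \<Rightarrow> real) \<Rightarrow> int \<Rightarrow> real" where
  "neighbour_avg b i = (b i + b (i + 1)) / 2"

lemma neighbour_avg_funpow_Suc:
  "(neighbour_avg ^^ Suc N) b i = ((neighbour_avg ^^ N) b i + (neighbour_avg ^^ N) b (i + 1)) / 2"
  by (simp add: neighbour_avg_def[of "(neighbour_avg ^^ N) b"])

lemma neighbour_avg_funpow_le:
  assumes "\<And>i. b i \<le> C"
  shows "(neighbour_avg ^^ N) b i \<le> C"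
proof (induction N arbitrary: i)
  case (Suc N)
  show ?case
    using Suc[of i] Suc[of "i + 1"] by (simp add: neighbour_avg_funpow_Suc del: funpow.simps)
qed (simp add: assms)

lemma neighbour_avg_funpow_ge:
  assumes "\<And>i. C \<le> b i"
  shows "C \<le> (neighbour_avg ^^ N) b i"
proof (induction N arbitrary: i)
  case (Suc N)
  show ?case
    using Suc[of i] Suc[of "i + 1"] by (simp add: neighbour_avg_funpow_Suc del: funpow.simps)
qed (simp add: assms)

lemma neighbour_avg_funpow_abs_le:
  assumes "\<And>i. \<bar>b i\<bar> \<le> K"
  shows "\<bar>(neighbour_avg ^^ N) b i\<bar> \<le> K"
proof -
  have "b j \<le> K" "- K \<le> b j" for j
    using assms[of j] by linarith+
  then show ?thesis
    using neighbour_avg_funpow_le[of b K N i] neighbour_avg_funpow_ge[of "- K" b N i]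
    by (simp add: abs_le_iff)
qed

text \<open>Averaging is linear, commutes with translation and fixes constants, so it can be applied
  to both sides of the difference equation.\<close>

lemma neighbour_avg_funpow_diff:
  assumes "\<And>i. x (i + 1) - x i = b i - c"
  shows "(neighbour_avg ^^ N) x (i + 1) - (neighbour_avg ^^ N) x i = (neighbour_avg ^^ N) b i - c"
proof (induction N arbitrary: i)
  case (Suc N)
  show ?case
    using Suc[of i] Suc[of "i + 1"]
    by (simp add: neighbour_avg_funpow_Suc field_simps del: funpow.simps)
qed (simp add: assms)

lemma bounded_above_increments_not_ge:
  fixes x :: "nat \<Rightarrow> real"
  assumes "d > 0" "\<And>n. x n + d \<le> x (Suc n)" "\<And>n. x n \<le> C"
  shows False
proof -
  have lin: "x 0 + real n * d \<le> x n" for n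
  proof (induction n)
    case (Suc n)
    then show ?case
      using assms(2)[of n] by (simp add: algebra_simps)
  qed simp
  obtain n where "C - x 0 < real n * d"
    using reals_Archimedean3[OF assms(1)] by blast
  with lin[of n] assms(3)[of n] show False
    by linarith
qed

text \<open>After enough averaging, all increments of the averaged \<open>x\<close> are close to
  \<open>l - c\<close>. A nonzero \<open>l - c\<close> would make them share a sign and stay away
  from zero, giving linear growth in one direction against the bound \<open>C\<close>.\<close>

lemma neighbour_avg_uniform_limit_eq:
  fixes x b :: "int \<Rightarrow> real"
  assumes diff: "\<And>i. x (i + 1) - x i = b i - c" and bound: "\<And>i. x i \<le> C"
    and lim: "\<And>e. e > 0 \<Longrightarrow> \<exists>N. \<forall>i. \<bar>(neighbour_avg ^^ N) b i - l\<bar> \<le> e"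
  shows "l = c"
proof (rule ccontr)
  assume "l \<noteq> c"
  \<comment> \<open>Half the gap: increments within \<open>d\<close> of \<open>l - c\<close>, which
    has modulus \<open>2 * d\<close>, still have modulus at least \<open>d\<close>.\<close>
  define d where "d = \<bar>l - c\<bar> / 2"
  have d: "d > 0"
    using \<open>l \<noteq> c\<close> by (simp add: d_def)
  obtain N where N: "\<And>i. \<bar>(neighbour_avg ^^ N) b i - l\<bar> \<le> d"
    using lim[OF d] by blast
  define y where "y = (neighbour_avg ^^ N) x"
  have y: "y (i + 1) - y i = (neighbour_avg ^^ N) b i - c" for i
    unfolding y_def by (rule neighbour_avg_funpow_diff) (rule diff)
  have yC: "y i \<le> C" for i
    unfolding y_def by (rule neighbour_avg_funpow_le) (rule bound)
  show False
  proof (cases "l > c")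
    case True
    show False
    proof (rule bounded_above_increments_not_ge[OF d, of "\<lambda>n. y (int n)"])
      show "y (int n) + d \<le> y (int (Suc n))" for n
      proof -
        have "l - c = 2 * d"
          using True by (simp add: d_def)
        moreover have "l - d \<le> (neighbour_avg ^^ N) b (int n)"
          using N[of "int n"] by linarith
        ultimately show ?thesis
          using y[of "int n"] by (simp add: add.commute)
      qed
    qed (rule yC)
  next
    \<comment> \<open>Here \<open>y\<close> falls to the right, so it is followed to the left, where
      it grows; the increment is taken at \<open>- int (Suc n)\<close>.\<close>
    case False
    show False
    proof (rule bounded_above_increments_not_ge[OF d, of "\<lambda>n. y (- int n)"])
      show "y (- int n) + d \<le> y (- int (Suc n))" for n
      proof -
        have "c - l = 2 * d"
          using False by (simp add: d_def)
        moreover have "(neighbour_avg ^^ N) b (- int (Suc n)) \<le> l + d"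
          using N[of "- int (Suc n)"] by linarith
        ultimately show ?thesis
          using y[of "- int (Suc n)"] by simp
      qed
    qed (rule yC)
  qed
qed

section \<open>The Aluthge transform of a weighted shift\<close>

text \<open>One family covers the adjoint of a weighted shift (\<open>k = 1\<close>) and diagonal
  operators (\<open>k = 0\<close>). Unlike in \<open>weighted_shift\<close>, weights are indexed by
  the output coordinate.\<close>

definition shift_op :: "(int \<Rightarrow> complex) \<Rightarrow> int \<Rightarrow> int ell2 \<Rightarrow>\<^sub>L int ell2" where
  "shift_op a k = Blinfun (\<lambda>x. Abs_ell2 (\<lambda>i. a i * ell2_nth x (i + k)))"

text \<open>A bound on finite sums of squared coordinates, obtained by translating the index set,
  gives both square summability for \<open>Abs_ell2\<close> and boundedness for
  \<open>Blinfun\<close>.\<close>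

lemma ell2_nth_shift_op:
  assumes "bounded (range a)"
  shows "ell2_nth (shift_op a k x) i = a i * ell2_nth x (i + k)"
proof -
  obtain K where K: "\<And>i. cmod (a i) \<le> K"
    using assms by (auto simp: bounded_iff)
  then have "0 \<le> K"
    using norm_ge_zero order_trans by blast
  have bound: "(\<Sum>i\<in>F. (cmod (a i * ell2_nth x (i + k)))\<^sup>2) \<le> (norm x * K)\<^sup>2"
    if "finite F" for F and x :: "int ell2"
  proof -
    have "(\<Sum>i\<in>F. (cmod (a i * ell2_nth x (i + k)))\<^sup>2)
        \<le> (\<Sum>i\<in>F. K\<^sup>2 * (cmod (ell2_nth x (i + k)))\<^sup>2)"
      by (intro sum_mono) (auto simp: norm_mult power_mult_distrib intro!: mult_right_mono power_mono K)
    also have "\<dots> = K\<^sup>2 * (\<Sum>i\<in>(\<lambda>i. i + k) ` F. (cmod (ell2_nth x i))\<^sup>2)"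
      by (simp add: sum_distrib_left sum.reindex inj_on_def)
    also have "\<dots> \<le> K\<^sup>2 * (norm x)\<^sup>2"
      using that by (intro mult_left_mono ell2_sum_le_norm) auto
    finally show ?thesis
      by (simp add: power_mult_distrib mult.commute)
  qed
  define W where "W = (\<lambda>x. Abs_ell2 (\<lambda>i. a i * ell2_nth x (i + k)))"
  have W: "ell2_nth (W x) i = a i * ell2_nth x (i + k)" for x i
    unfolding W_def by (rule ell2_nth_Abs, rule square_summableI, rule bound)
  have "bounded_linear W"
  proof (rule bounded_linear_intro)
    show "W (x + y) = W x + W y" "W (r *\<^sub>R x) = r *\<^sub>R W x" for x y r
      by (rule ell2_eqI; simp add: W algebra_simps)+
    show "norm (W x) \<le> norm x * K" for x
      using bound[of _ x] \<open>0 \<le> K\<close> by (intro norm_ell2_leI) (auto simp: W)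
  qed
  then have "blinfun_apply (shift_op a k) = W"
    unfolding shift_op_def W_def by (rule bounded_linear_Blinfun_apply)
  then show ?thesis
    by (simp add: W)
qed

lemma complex_linear_shift_op: "bounded (range a) \<Longrightarrow> complex_linear (shift_op a k)"
  unfolding complex_linear_def by (auto intro!: ell2_eqI simp: ell2_nth_shift_op)

section \<open>Coordinates as inner products, and self-adjointness of positive operators\<close>

lemma cinner_basis_right [simp]: "cinner x (ell2_basis i) = ell2_nth x i"
proof -
  have "cinner x (ell2_basis i) = (\<Sum>\<^sub>\<infinity>j\<in>{i}. ell2_nth x j * cnj (ell2_nth (ell2_basis i) j))"
    unfolding cinner_ell2_def by (rule infsum_cong_neutral) auto
  then show ?thesis
    by simp
qed

lemma norm_ell2_basis [simp]: "norm (ell2_basis i) = 1"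
proof -
  have "complex_of_real ((norm (ell2_basis i))\<^sup>2) = 1"
    unfolding cinner_self[symmetric] by simp
  then have "(norm (ell2_basis i))\<^sup>2 = 1"
    using of_real_eq_1_iff by blast
  then show ?thesis
    by (simp add: power2_eq_1_iff) (metis norm_ge_zero not_one_le_zero neg_0_le_iff_le)
qed

lemma cinner_add_right: "cinner x (y + z) = cinner x y + cinner x (z :: 'a::complex_inner)"
  using arg_cong[OF cinner_add_left[of y z x], of cnj] by (simp flip: cinner_commute)

lemma cinner_scaleC_right: "cinner x (a *\<^sub>C y) = cnj a * cinner x (y :: 'a::complex_inner)"
  using arg_cong[OF cinner_scaleC_left[of a y x], of cnj] by (simp flip: cinner_commute)

text \<open>Polarization: the quadratic form is real at \<open>x + y\<close> and at
  \<open>x + \<i> *\<^sub>C y\<close>, which compares the imaginary and the real parts of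
  \<open>cinner (A x) y\<close> and \<open>cinner (A y) x\<close>.\<close>

lemma positive_op_selfadjoint:
  assumes "positive_op A"
  shows "cinner (A x) y = cinner x (A y)"
proof -
  have lin: "A (a *\<^sub>C x) = a *\<^sub>C A x" for a x
    using assms unfolding positive_op_def complex_linear_def by blast
  have re: "Im (cinner (A x) x) = 0" for x
    using assms unfolding positive_op_def by (simp add: complex_is_Real_iff)
  have "Im (cinner (A x) y + cinner (A y) x) = 0"
    using re[of "x + y"] re[of x] re[of y]
    by (simp add: blinfun.add_right cinner_add_left cinner_add_right)
  moreover have "Im (- \<i> * cinner (A x) y + \<i> * cinner (A y) x) = 0"
    using re[of "x + \<i> *\<^sub>C y"] re[of x] re[of y]
    by (simp add: blinfun.add_right lin cinner_add_left cinner_add_right cinner_scaleC_left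
        cinner_scaleC_right)
  ultimately have "cinner (A x) y = cnj (cinner (A y) x)"
    by (simp add: complex_eq_iff)
  then show ?thesis
    by (simp add: cinner_commute[of x])
qed

lemma bounded_range_mult:
  fixes s t :: "'i \<Rightarrow> real"
  assumes "bounded (range s)" "bounded (range t)"
  shows "bounded (range (\<lambda>i. s i * t i))"
proof -
  obtain S T where "\<And>i. \<bar>s i\<bar> \<le> S" "\<And>i. \<bar>t i\<bar> \<le> T"
    using assms by (auto simp: bounded_iff)
  then have "\<bar>s i * t i\<bar> \<le> S * T" for i
    unfolding abs_mult by (meson abs_ge_zero mult_mono order_trans)
  then show ?thesis
    by (auto simp: bounded_iff)
qed

section \<open>Diagonal operators and their positive square roots\<close>

definition diag_op :: "(int \<Rightarrow> real) \<Rightarrow> int ell2 \<Rightarrow>\<^sub>L int ell2" where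
  "diag_op s = shift_op (\<lambda>i. complex_of_real (s i)) 0"

lemma bounded_range_of_real:
  "bounded (range s) \<Longrightarrow> bounded (range (\<lambda>i. complex_of_real (s i)))"
  by (simp add: bounded_iff)

lemma ell2_nth_diag_op:
  "bounded (range s) \<Longrightarrow> ell2_nth (diag_op s x) i = complex_of_real (s i) * ell2_nth x i"
  unfolding diag_op_def by (simp add: ell2_nth_shift_op bounded_range_of_real)

lemma positive_op_diag_op:
  assumes "bounded (range s)" "\<And>i. 0 \<le> s i"
  shows "positive_op (diag_op s)"
  unfolding positive_op_def
proof (intro conjI allI)
  show "complex_linear (diag_op s)"
    unfolding diag_op_def by (intro complex_linear_shift_op bounded_range_of_real assms)
  fix x
  have "cinner (diag_op s x) x = (\<Sum>\<^sub>\<infinity>i. complex_of_real (s i * (cmod (ell2_nth x i))\<^sup>2))"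
    unfolding cinner_ell2_def ell2_nth_diag_op[OF assms(1)]
    by (simp add: mult.assoc complex_norm_square[symmetric])
  moreover have "(\<lambda>i. complex_of_real (s i * (cmod (ell2_nth x i))\<^sup>2)) summable_on UNIV"
    using square_summable_mult[OF ell2_nth_summable ell2_nth_summable, of "diag_op s x" x]
    unfolding ell2_nth_diag_op[OF assms(1)] by (simp add: mult.assoc complex_norm_square[symmetric])
  then have "(\<lambda>i. s i * (cmod (ell2_nth x i))\<^sup>2) summable_on UNIV"
    using summable_on_Re by fastforce
  then have "(\<Sum>\<^sub>\<infinity>i. complex_of_real (s i * (cmod (ell2_nth x i))\<^sup>2))
      = complex_of_real (\<Sum>\<^sub>\<infinity>i. s i * (cmod (ell2_nth x i))\<^sup>2)"
    by (intro infsumI has_sum_of_real has_sum_infsum)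
  moreover have "0 \<le> (\<Sum>\<^sub>\<infinity>i. s i * (cmod (ell2_nth x i))\<^sup>2)"
    by (intro infsum_nonneg) (simp add: assms)
  ultimately show "cinner (diag_op s x) x \<in> \<real>" "0 \<le> Re (cinner (diag_op s x) x)"
    by simp_all
qed

lemma diag_op_compose:
  assumes "bounded (range s)" "bounded (range t)"
  shows "diag_op s o\<^sub>L diag_op t = diag_op (\<lambda>i. s i * t i)"
proof -
  have "bounded (range (\<lambda>i. s i * t i))"
    using bounded_range_mult[OF assms] by simp
  with assms show ?thesis
    by (intro blinfun_eqI ell2_eqI) (simp add: ell2_nth_diag_op)
qed

text \<open>A positive square root \<open>B\<close> is pinned down on the basis by \<open>(B + s\<^sub>i) (B - s\<^sub>i) e\<^sub>i = 0\<close>,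
  where \<open>B + s\<^sub>i\<close> is injective because \<open>s\<^sub>i > 0\<close>.\<close>

lemma sqrt_op_diag_op:
  assumes bdd: "bounded (range s)" and pos: "\<And>i. 0 < s i"
  shows "sqrt_op (diag_op (\<lambda>i. s i * s i)) = diag_op s"
  unfolding sqrt_op_def
proof (rule the_equality)
  show "positive_op (diag_op s) \<and> diag_op s o\<^sub>L diag_op s = diag_op (\<lambda>i. s i * s i)"
    using assms by (simp add: positive_op_diag_op diag_op_compose less_imp_le)
next
  fix B assume B: "positive_op B \<and> B o\<^sub>L B = diag_op (\<lambda>i. s i * s i)"
  have bdd2: "bounded (range (\<lambda>i. s i * s i))"
    using bounded_range_mult[OF bdd bdd] by simp
  have lin: "B (a *\<^sub>C x) = a *\<^sub>C B x" for a x
    using B unfolding positive_op_def complex_linear_def by blast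
  have Bbasis: "B (ell2_basis i) = complex_of_real (s i) *\<^sub>C ell2_basis i" for i
  proof -
    define c where "c = complex_of_real (s i)"
    define y where "y = B (ell2_basis i) - c *\<^sub>C ell2_basis i"
    have "B (B (ell2_basis i)) = diag_op (\<lambda>i. s i * s i) (ell2_basis i)"
      using B by (metis blinfun_apply_blinfun_compose)
    also have "\<dots> = (c * c) *\<^sub>C ell2_basis i"
      by (rule ell2_eqI) (simp add: ell2_nth_diag_op bdd2 c_def)
    finally have "B y = - (c *\<^sub>C y)"
      by (simp add: y_def blinfun.diff_right lin scaleC_diff_right scaleC_scaleC)
    moreover have "0 \<le> Re (cinner (B y) y)"
      using B unfolding positive_op_def by blast
    moreover have "- (c *\<^sub>C y) = (- c) *\<^sub>C y"
      using scaleC_add_left[of c "- c" y] by (simp add: add_eq_0_iff)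
    ultimately have "s i * (norm y)\<^sup>2 \<le> 0"
      by (simp add: cinner_scaleC_left cinner_self c_def)
    with pos[of i] have "y = 0"
      by (simp add: mult_le_0_iff not_le)
    then show ?thesis
      by (simp add: y_def c_def)
  qed
  show "B = diag_op s"
  proof (intro blinfun_eqI ell2_eqI)
    fix x i
    \<comment> \<open>Self-adjointness expresses every coordinate of \<open>B x\<close> through
      \<open>B\<close> on the basis, so no density argument is required.\<close>
    have "ell2_nth (B x) i = cinner x (B (ell2_basis i))"
      using positive_op_selfadjoint[of B x "ell2_basis i"] B by simp
    then show "ell2_nth (B x) i = ell2_nth (diag_op s x) i"
      by (simp add: Bbasis cinner_scaleC_right ell2_nth_diag_op bdd)
  qed
qed

section \<open>Adjoint, polar decomposition and Aluthge transform\<close>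

lemma adjoint_op_eqI:
  fixes T S :: "'a::{complex_inner, banach} \<Rightarrow>\<^sub>L 'a"
  assumes "\<And>x y. cinner (T x) y = cinner x (S y)"
  shows "adjoint_op T = S"
  unfolding adjoint_op_def
proof (rule the_equality)
  fix S' :: "'a \<Rightarrow>\<^sub>L 'a" assume S': "\<forall>x y. cinner (T x) y = cinner x (S' y)"
  show "S' = S"
  proof (rule blinfun_eqI)
    fix y
    \<comment> \<open>Uniqueness: \<open>S' y - S y\<close> is orthogonal to every vector, in
      particular to itself.\<close>
    have *: "cinner (S' y - S y) (S' y) = cinner (S' y - S y) (S y)"
      using S' assms by metis
    have "cinner (S' y - S y) (S' y - S y) + cinner (S' y - S y) (S y) = cinner (S' y - S y) (S' y)"
      by (simp flip: cinner_add_right)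
    with * have "cinner (S' y - S y) (S' y - S y) = 0"
      by simp
    then show "S' y = S y"
      by (simp add: cinner_self)
  qed
qed (use assms in blast)

lemma adjoint_op_weighted_shift:
  assumes "bounded (range \<alpha>)"
  shows "adjoint_op (weighted_shift \<alpha>) = shift_op (\<lambda>i. cnj (\<alpha> i)) 1"
proof (rule adjoint_op_eqI)
  fix x y
  have bdd: "bounded (range (\<lambda>i. cnj (\<alpha> i)))"
    using assms by (simp add: bounded_iff)
  have "bij_betw (\<lambda>i. i + 1) UNIV (UNIV :: int set)"
    by (rule bij_betw_byWitness[where f' = "\<lambda>i. i - 1"]) auto
  from infsum_reindex_bij_betw[OF this, of "\<lambda>i. \<alpha> (i - 1) * ell2_nth x (i - 1) * cnj (ell2_nth y i)"]
  show "cinner (weighted_shift \<alpha> x) y = cinner x (shift_op (\<lambda>i. cnj (\<alpha> i)) 1 y)"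
    by (simp add: cinner_ell2_def ell2_nth_weighted_shift assms ell2_nth_shift_op bdd mult_ac)
qed

text \<open>Weights in polar form, with the modulus stored as the logarithm \<open>b\<close>, so
  that the transform acts linearly on \<open>b\<close> and leaves the phases \<open>u\<close>
  alone.\<close>

definition polar_weight :: "(int \<Rightarrow> real) \<Rightarrow> (int \<Rightarrow> complex) \<Rightarrow> int \<Rightarrow> complex" where
  "polar_weight b u i = complex_of_real (exp (b i)) * u i"

lemma bounded_range_exp:
  fixes b :: "'i \<Rightarrow> real"
  assumes "\<And>i. b i \<le> K"
  shows "bounded (range (\<lambda>i. exp (b i)))"
  using assms by (auto simp: bounded_iff)

lemma bounded_range_polar_weight:
  assumes "\<And>i. b i \<le> K" "\<And>i. cmod (u i) = 1"
  shows "bounded (range (polar_weight b u))"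
  using bounded_range_exp[OF assms(1)] assms(2) by (simp add: bounded_iff polar_weight_def norm_mult)

lemma ell2_nth_polar_shift:
  assumes "\<And>i. b i \<le> K" "\<And>i. cmod (u i) = 1"
  shows "ell2_nth (weighted_shift (polar_weight b u) x) i
    = complex_of_real (exp (b (i - 1))) * (u (i - 1) * ell2_nth x (i - 1))"
  using ell2_nth_weighted_shift[OF bounded_range_polar_weight[of b _ u, OF assms]]
  by (simp add: polar_weight_def mult.assoc)

text \<open>The phases cancel in the product of adjoint and operator, which is diagonal with entries
  \<open>exp (b i) * exp (b i)\<close>.\<close>

lemma abs_op_polar_weight:
  assumes b: "\<And>i. b i \<le> K" and u: "\<And>i. cmod (u i) = 1"
  shows "abs_op (weighted_shift (polar_weight b u)) = diag_op (\<lambda>i. exp (b i))"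
proof -
  note bdd = bounded_range_polar_weight[of b _ u, OF b u]
  have bdd': "bounded (range (\<lambda>i. cnj (polar_weight b u i)))"
    using bdd by (simp add: bounded_iff)
  have bdd2: "bounded (range (\<lambda>i. exp (b i) * exp (b i)))"
    using bounded_range_mult[OF bounded_range_exp[of b, OF b] bounded_range_exp[of b, OF b]] by simp
  have uu: "cnj (u i) * (u i * w) = w" for i w
    using complex_norm_square[of "u i"] u[of i] by (simp add: mult_ac flip: mult.assoc)
  have "adjoint_op (weighted_shift (polar_weight b u)) o\<^sub>L weighted_shift (polar_weight b u)
      = diag_op (\<lambda>i. exp (b i) * exp (b i))"
  proof (intro blinfun_eqI ell2_eqI)
    fix x i
    show "ell2_nth ((adjoint_op (weighted_shift (polar_weight b u)) o\<^sub>L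
        weighted_shift (polar_weight b u)) x) i = ell2_nth (diag_op (\<lambda>i. exp (b i) * exp (b i)) x) i"
      using uu[of i "ell2_nth x i"]
      by (simp add: adjoint_op_weighted_shift ell2_nth_shift_op ell2_nth_weighted_shift
          ell2_nth_polar_shift[of b _ u, OF b u] ell2_nth_diag_op bdd bdd' bdd2 mult_ac)
        (simp add: polar_weight_def mult_ac)
  qed
  then show ?thesis
    unfolding abs_op_def by (simp add: sqrt_op_diag_op bounded_range_exp[OF b])
qed

lemma norm_weighted_shift_unimodular:
  assumes u: "\<And>i. cmod (u i) = 1"
  shows "norm (weighted_shift u x) = norm x"
proof -
  have bdd: "bounded (range u)"
    using u by (auto simp: bounded_iff)
  have "bij_betw (\<lambda>i. i - 1) UNIV (UNIV :: int set)"
    by (rule bij_betw_byWitness[where f' = "\<lambda>i. i + 1"]) auto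
  from infsum_reindex_bij_betw[OF this, of "\<lambda>i. (cmod (ell2_nth x i))\<^sup>2"]
  show ?thesis
    by (simp add: norm_ell2_def ell2_nth_weighted_shift bdd norm_mult u)
qed

text \<open>The weights never vanish, so the kernels are trivial, and the shift by unimodular
  \<open>u\<close> is an isometry. Uniqueness comes from cancelling the modulus on the
  right.\<close>

lemma polar_factor_polar_weight:
  assumes b: "\<And>i. \<bar>b i\<bar> \<le> K" and u: "\<And>i. cmod (u i) = 1"
  shows "polar_factor (weighted_shift (polar_weight b u)) = weighted_shift u"
proof -
  have bK: "b i \<le> K" "- b i \<le> K" for i
    using b[of i] by linarith+
  note bdd = bounded_range_polar_weight[of b _ u, OF bK(1) u]
  note bdde = bounded_range_exp[of b, OF bK(1)] bounded_range_exp[of "\<lambda>i. - b i", OF bK(2)]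
  have bddu: "bounded (range u)"
    using u by (auto simp: bounded_iff)
  have u0: "u i \<noteq> 0" for i
    using u[of i] by auto
  have abs: "abs_op (weighted_shift (polar_weight b u)) = diag_op (\<lambda>i. exp (b i))"
    by (rule abs_op_polar_weight[OF bK(1) u])
  have ker: "kernel_op (weighted_shift v) = {0}" if "bounded (range v)" "\<And>i. v i \<noteq> 0" for v
  proof -
    have "x = 0" if "weighted_shift v x = 0" for x
    proof (rule ell2_eqI)
      fix i
      have "ell2_nth (weighted_shift v x) (i + 1) = 0"
        using that by simp
      then show "ell2_nth x i = ell2_nth 0 i"
        using \<open>\<And>i. v i \<noteq> 0\<close> by (simp add: ell2_nth_weighted_shift \<open>bounded (range v)\<close>)
    qed
    then show ?thesis
      unfolding kernel_op_def by (auto simp: blinfun.zero_right)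
  qed
  have fac: "weighted_shift (polar_weight b u) = weighted_shift u o\<^sub>L diag_op (\<lambda>i. exp (b i))"
    by (intro blinfun_eqI ell2_eqI)
      (simp add: ell2_nth_polar_shift[of b _ u, OF bK(1) u] ell2_nth_weighted_shift ell2_nth_diag_op
        bddu bdde mult_ac)
  show ?thesis
    unfolding polar_factor_def abs
  proof (rule the_equality)
    show "partial_isometry (weighted_shift u) \<and>
        kernel_op (weighted_shift u) = kernel_op (weighted_shift (polar_weight b u)) \<and>
        weighted_shift (polar_weight b u) = weighted_shift u o\<^sub>L diag_op (\<lambda>i. exp (b i))"
      using fac ker[OF bddu] ker[OF bdd] u0
      by (auto simp: partial_isometry_def complex_linear_weighted_shift bddu
          norm_weighted_shift_unimodular[OF u] polar_weight_def)
  next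
    fix V assume "partial_isometry V \<and>
        kernel_op V = kernel_op (weighted_shift (polar_weight b u)) \<and>
        weighted_shift (polar_weight b u) = V o\<^sub>L diag_op (\<lambda>i. exp (b i))"
    then have V: "V o\<^sub>L diag_op (\<lambda>i. exp (b i)) = weighted_shift u o\<^sub>L diag_op (\<lambda>i. exp (b i))"
      using fac by metis
    show "V = weighted_shift u"
    proof (rule blinfun_eqI)
      fix x
      \<comment> \<open>The right inverse of the modulus is bounded because \<open>b\<close> is
        bounded below.\<close>
      have "diag_op (\<lambda>i. exp (b i)) (diag_op (\<lambda>i. exp (- b i)) x) = x"
        by (rule ell2_eqI)
          (simp add: ell2_nth_diag_op bdde mult.assoc[symmetric] flip: of_real_mult exp_add)
      then show "V x = weighted_shift u x"
        using V by (metis blinfun_apply_blinfun_compose)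
    qed
  qed
qed

text \<open>Reading the product on the \<open>i\<close>-th basis vector: one square root contributes
  \<open>exp (b i / 2)\<close> before the shift, the other \<open>exp (b (i + 1) / 2)\<close> after
  it.\<close>

lemma aluthge_polar_weight:
  assumes b: "\<And>i. \<bar>b i\<bar> \<le> K" and u: "\<And>i. cmod (u i) = 1"
  shows "aluthge (weighted_shift (polar_weight b u))
    = weighted_shift (polar_weight (neighbour_avg b) u)"
proof -
  have bK: "b i \<le> K" for i
    using b[of i] by linarith
  have half: "b i / 2 \<le> K / 2" for i
    using bK[of i] by simp
  have avg: "neighbour_avg b i \<le> K" for i
    using bK[of i] bK[of "i + 1"] by (simp add: neighbour_avg_def)
  have bddu: "bounded (range u)"
    using u by (auto simp: bounded_iff)
  note bdd = bounded_range_polar_weight[of "neighbour_avg b" _ u, OF avg u]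
    bounded_range_exp[of "\<lambda>i. b i / 2", OF half] bddu
  have "sqrt_op (diag_op (\<lambda>i. exp (b i))) = diag_op (\<lambda>i. exp (b i / 2))"
    using sqrt_op_diag_op[OF bdd(2)] by (simp flip: exp_add)
  then have "aluthge (weighted_shift (polar_weight b u))
      = diag_op (\<lambda>i. exp (b i / 2)) o\<^sub>L weighted_shift u o\<^sub>L diag_op (\<lambda>i. exp (b i / 2))"
    unfolding aluthge_def abs_op_polar_weight[OF bK u] polar_factor_polar_weight[OF b u] by simp
  also have "\<dots> = weighted_shift (polar_weight (neighbour_avg b) u)"
  proof (intro blinfun_eqI ell2_eqI)
    fix x i
    have "exp (neighbour_avg b (i - 1)) = exp (b i / 2) * exp (b (i - 1) / 2)"
      by (simp add: neighbour_avg_def add_divide_distrib add.commute flip: exp_add)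
    then show "ell2_nth ((diag_op (\<lambda>i. exp (b i / 2)) o\<^sub>L weighted_shift u o\<^sub>L
        diag_op (\<lambda>i. exp (b i / 2))) x) i
        = ell2_nth (weighted_shift (polar_weight (neighbour_avg b) u) x) i"
      by (simp add: ell2_nth_polar_shift[of "neighbour_avg b" _ u, OF avg u] ell2_nth_weighted_shift
          ell2_nth_diag_op bdd mult_ac)
  qed
  finally show ?thesis .
qed

lemma aluthge_iterate_polar_weight:
  assumes b: "\<And>i. \<bar>b i\<bar> \<le> K" and u: "\<And>i. cmod (u i) = 1"
  shows "aluthge_iterate N (weighted_shift (polar_weight b u))
    = weighted_shift (polar_weight ((neighbour_avg ^^ N) b) u)"
proof (induction N)
  case (Suc N)
  with aluthge_polar_weight[OF neighbour_avg_funpow_abs_le[OF b] u] show ?case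
    by (simp add: aluthge_iterate_def)
qed (simp add: aluthge_iterate_def)

section \<open>Norm limits of the iterates\<close>

text \<open>The logarithm is Lipschitz with constant \<open>exp K\<close> above
  \<open>exp (- K)\<close>. With the smaller argument \<open>t\<close> factored out, this is
  \<open>1 + h \<le> exp h\<close> together with \<open>exp (K + t) \<ge> 1\<close>.\<close>

lemma abs_diff_le_exp_diff:
  fixes x y :: real
  assumes "- K \<le> x" "- K \<le> y"
  shows "\<bar>x - y\<bar> \<le> exp K * \<bar>exp x - exp y\<bar>"
proof -
  have *: "s - t \<le> exp K * \<bar>exp s - exp t\<bar>" if "- K \<le> t" "t \<le> s" for s t :: real
  proof -
    have "1 + (s - t) \<le> exp (s - t)"
      by (rule exp_ge_add_one_self)
    then have "s - t \<le> exp (s - t) - 1"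
      by linarith
    also have "\<dots> \<le> exp (K + t) * (exp (s - t) - 1)"
      using that mult_right_mono[of 1 "exp (K + t)" "exp (s - t) - 1"] by simp
    also have "\<dots> = exp K * (exp s - exp t)"
      by (simp add: algebra_simps flip: exp_add)
    also have "\<dots> = exp K * \<bar>exp s - exp t\<bar>"
      using that by simp
    finally show ?thesis .
  qed
  show ?thesis
    using *[of y x] *[of x y] assms by (cases "x \<le> y") (auto simp: abs_minus_commute)
qed

text \<open>Testing on basis vectors, the operator norm dominates each difference of weights
  uniformly in \<open>i\<close>; the common phases drop out, and the Lipschitz estimate passes to
  logarithms.\<close>

lemma weights_uniformly_Cauchy:
  assumes K: "\<And>N i. \<bar>c N i\<bar> \<le> K" and u: "\<And>i. cmod (u i) = 1"
    and conv: "convergent (\<lambda>N::nat. weighted_shift (polar_weight (c N) u))" and "e > 0"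
  shows "\<exists>N0. \<forall>m\<ge>N0. \<forall>n\<ge>N0. \<forall>i. \<bar>c m i - c n i\<bar> < e"
proof -
  let ?W = "\<lambda>N. weighted_shift (polar_weight (c N) u)"
  have cK: "c N i \<le> K" "- K \<le> c N i" for N i
    using K[of N i] by linarith+
  have bdd: "bounded (range (polar_weight (c N) u))" for N
    by (rule bounded_range_polar_weight[OF cK(1) u])
  have exp_le: "\<bar>exp (c m i) - exp (c n i)\<bar> \<le> norm (?W m - ?W n)" for m n i
  proof -
    have "\<bar>exp (c m i) - exp (c n i)\<bar> = cmod (polar_weight (c m) u i - polar_weight (c n) u i)"
    proof -
      have "polar_weight (c m) u i - polar_weight (c n) u i
          = complex_of_real (exp (c m i) - exp (c n i)) * u i"
        by (simp add: polar_weight_def algebra_simps)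
      then show ?thesis
        by (simp only: norm_mult u norm_of_real mult_1_right)
    qed
    also have "\<dots> = cmod (ell2_nth ((?W m - ?W n) (ell2_basis i)) (i + 1))"
      by (simp add: blinfun.diff_left ell2_nth_weighted_shift bdd)
    also have "\<dots> \<le> norm ((?W m - ?W n) (ell2_basis i))"
      by (rule ell2_nth_le_norm)
    also have "\<dots> \<le> norm (?W m - ?W n)"
      using norm_blinfun[of "?W m - ?W n" "ell2_basis i"] by simp
    finally show ?thesis .
  qed
  \<comment> \<open>The factor \<open>exp (- K)\<close> compensates the Lipschitz constant
    \<open>exp K\<close>.\<close>
  obtain N0 where N0: "\<forall>m\<ge>N0. \<forall>n\<ge>N0. norm (?W m - ?W n) < e * exp (- K)"
    using CauchyD[OF convergent_Cauchy[OF conv], of "e * exp (- K)"] \<open>e > 0\<close> by auto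
  have "\<bar>c m i - c n i\<bar> < e" if "m \<ge> N0" "n \<ge> N0" for m n i
  proof -
    have "\<bar>c m i - c n i\<bar> \<le> exp K * \<bar>exp (c m i) - exp (c n i)\<bar>"
      by (rule abs_diff_le_exp_diff) (rule cK)+
    also have "\<dots> \<le> exp K * norm (?W m - ?W n)"
      using exp_le by (intro mult_left_mono) auto
    also have "\<dots> < exp K * (e * exp (- K))"
      using N0 that by (intro mult_strict_left_mono) auto
    also have "\<dots> = e"
      by (simp add: exp_minus)
    finally show ?thesis .
  qed
  then show ?thesis
    by blast
qed

text \<open>The pointwise limit is fixed by averaging, so neighbouring values agree and it is
  constant; the uniform Cauchy property makes the convergence uniform.\<close>

lemma neighbour_avg_uniform_limit_const:
  assumes Cauchy: "\<And>e. e > 0 \<Longrightarrow>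
      \<exists>N0. \<forall>m\<ge>N0. \<forall>n\<ge>N0. \<forall>i. \<bar>(neighbour_avg ^^ m) b i - (neighbour_avg ^^ n) b i\<bar> < e"
  obtains l where "\<And>e. e > 0 \<Longrightarrow> \<exists>N. \<forall>i. \<bar>(neighbour_avg ^^ N) b i - l\<bar> \<le> e"
proof -
  let ?c = "\<lambda>N. (neighbour_avg ^^ N) b"
  have "\<exists>l. (\<lambda>N. ?c N i) \<longlonglongrightarrow> l" for i
  proof -
    have "Cauchy (\<lambda>N. ?c N i)"
      by (rule CauchyI) (use Cauchy in \<open>fastforce\<close>)
    then show ?thesis
      by (simp add: Cauchy_convergent_iff convergent_def)
  qed
  then obtain l where l: "\<And>i. (\<lambda>N. ?c N i) \<longlonglongrightarrow> l i"
    by metis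
  have step: "l (i + 1) = l i" for i
  proof -
    have "(\<lambda>N. ?c (Suc N) i) \<longlonglongrightarrow> (l i + l (i + 1)) / 2"
      unfolding neighbour_avg_funpow_Suc by (intro tendsto_intros l) simp
    moreover have "(\<lambda>N. ?c (Suc N) i) \<longlonglongrightarrow> l i"
      by (rule LIMSEQ_Suc[OF l])
    ultimately have "(l i + l (i + 1)) / 2 = l i"
      by (rule LIMSEQ_unique)
    then show ?thesis
      by simp
  qed
  have const: "l i = l 0" for i
  proof (induction i rule: int_induct[where k = 0])
    case (step2 i)
    then show ?case
      using step[of "i - 1"] by simp
  qed (simp_all add: step)
  have "\<exists>N. \<forall>i. \<bar>?c N i - l 0\<bar> \<le> e" if "e > 0" for e
  proof -
    obtain N where N: "\<And>n i. n \<ge> N \<Longrightarrow> \<bar>?c N i - ?c n i\<bar> < e"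
      using Cauchy[OF \<open>e > 0\<close>] by (metis order_refl)
    \<comment> \<open>Let the second index tend to infinity with \<open>N\<close> fixed; the strict
      bound becomes a weak one.\<close>
    have "\<bar>?c N i - l i\<bar> \<le> e" for i
    proof (rule LIMSEQ_le_const2)
      show "(\<lambda>n. \<bar>?c N i - ?c n i\<bar>) \<longlonglongrightarrow> \<bar>?c N i - l i\<bar>"
        by (intro tendsto_intros l)
      show "\<exists>M. \<forall>n\<ge>M. \<bar>?c N i - ?c n i\<bar> \<le> e"
        using N less_imp_le by blast
    qed
    then show ?thesis
      using const by metis
  qed
  with that show ?thesis
    by blast
qed

section \<open>Eigenvectors and invertibility of a weighted shift, and the conclusion\<close>

lemma weighted_shift_eigenvector_ln:
  assumes bdd: "bounded (range \<alpha>)" and nz: "\<And>i. \<alpha> i \<noteq> 0" and "z \<noteq> 0"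
    and x: "x \<noteq> 0" "weighted_shift \<alpha> x = z *\<^sub>C x"
  shows "ln (cmod (ell2_nth x (i + 1))) - ln (cmod (ell2_nth x i)) = ln (cmod (\<alpha> i)) - ln (cmod z)"
    and "ln (cmod (ell2_nth x i)) \<le> ln (norm x)"
proof -
  have rec: "\<alpha> i * ell2_nth x i = z * ell2_nth x (i + 1)" for i
    using arg_cong[OF x(2), of "\<lambda>y. ell2_nth y (i + 1)"] by (simp add: ell2_nth_weighted_shift bdd)
  \<comment> \<open>A vanishing coordinate would propagate in both directions and make
    \<open>x\<close> zero; hence all logarithms below are of positive numbers.\<close>
  then have iff: "ell2_nth x (i + 1) = 0 \<longleftrightarrow> ell2_nth x i = 0" for i
    using nz \<open>z \<noteq> 0\<close> by (metis mult_eq_0_iff)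
  have "ell2_nth x i = 0 \<longleftrightarrow> ell2_nth x 0 = 0" for i
  proof (induction i rule: int_induct[where k = 0])
    case (step2 i)
    then show ?case
      using iff[of "i - 1"] by simp
  qed (simp_all add: iff)
  then have xnz: "ell2_nth x i \<noteq> 0" for i
    using x(1) by (metis ell2_eqI ell2_nth_zero)
  have "ln (cmod (\<alpha> i * ell2_nth x i)) = ln (cmod (z * ell2_nth x (i + 1)))"
    by (simp only: rec)
  then show "ln (cmod (ell2_nth x (i + 1))) - ln (cmod (ell2_nth x i)) = ln (cmod (\<alpha> i)) - ln (cmod z)"
    using xnz nz \<open>z \<noteq> 0\<close> by (simp add: norm_mult ln_mult)
  show "ln (cmod (ell2_nth x i)) \<le> ln (norm x)"
    using xnz x(1) by (simp add: ell2_nth_le_norm)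
qed

text \<open>Applying the bounded inverse to the image of a unit basis vector bounds
  \<open>cmod (\<alpha> i)\<close> away from zero; the upper bound is boundedness of
  \<open>\<alpha>\<close>.\<close>

lemma invertible_weighted_shift_ln_bounded:
  assumes bdd: "bounded (range \<alpha>)" and inv: "invertible_op (weighted_shift \<alpha>)"
  obtains K where "\<And>i. \<alpha> i \<noteq> 0" "\<And>i. \<bar>ln (cmod (\<alpha> i))\<bar> \<le> K"
proof -
  let ?S = "inverse_op (weighted_shift \<alpha>)"
  obtain C where C: "\<And>i. cmod (\<alpha> i) \<le> C"
    using bdd by (auto simp: bounded_iff)
  have low: "1 \<le> norm ?S * cmod (\<alpha> i)" for i
  proof -
    have "1 = norm (?S (weighted_shift \<alpha> (ell2_basis i)))"
      by (simp add: inverse_op_apply[OF inv])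
    also have "\<dots> \<le> norm ?S * norm (weighted_shift \<alpha> (ell2_basis i))"
      by (rule norm_blinfun)
    finally show ?thesis
      by (simp add: weighted_shift_basis bdd norm_scaleC)
  qed
  have nz: "\<alpha> i \<noteq> 0" for i
    using low[of i] by auto
  have S: "norm ?S > 0"
    using low[of 0] by (cases "norm ?S = 0") auto
  have "\<bar>ln (cmod (\<alpha> i))\<bar> \<le> max (ln C) (ln (norm ?S))" for i
  proof -
    have "0 \<le> ln (norm ?S * cmod (\<alpha> i))"
      using low by (rule ln_ge_zero)
    then have "- ln (norm ?S) \<le> ln (cmod (\<alpha> i))"
      using S nz by (simp add: ln_mult)
    moreover have "ln (cmod (\<alpha> i)) \<le> ln C"
      using C nz by (simp add: ln_mono)
    ultimately show ?thesis
      by linarith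
  qed
  with nz show ?thesis
    by (rule that)
qed

theorem theorem2p7:
  fixes \<alpha> :: "int \<Rightarrow> complex" and T :: "int ell2 \<Rightarrow>\<^sub>L int ell2"
  assumes "bounded (range \<alpha>)"
    and "T = weighted_shift \<alpha>"
    and "shifted_hyperbolic T"
  shows "\<not> convergent (\<lambda>n. aluthge_iterate (Suc n) T)"
proof
  assume "convergent (\<lambda>n. aluthge_iterate (Suc n) T)"
  then have conv: "convergent (\<lambda>n. aluthge_iterate n T)"
    by (rule convergent_Suc_iff[THEN iffD1])
  have "invertible_op (weighted_shift \<alpha>)"
    using assms(2,3) unfolding shifted_hyperbolic_def by blast
  then obtain K where nz: "\<And>i. \<alpha> i \<noteq> 0" and K: "\<And>i. \<bar>ln (cmod (\<alpha> i))\<bar> \<le> K"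
    using invertible_weighted_shift_ln_bounded[OF assms(1)] by metis
  define b where "b = (\<lambda>i. ln (cmod (\<alpha> i)))"
  define u where "u = (\<lambda>i. sgn (\<alpha> i))"
  have b: "\<bar>b i\<bar> \<le> K" for i
    by (simp add: b_def K)
  have u: "cmod (u i) = 1" for i
    by (simp add: u_def norm_sgn nz)
  have "\<alpha> = polar_weight b u"
    using nz by (intro ext) (simp add: polar_weight_def b_def u_def sgn_eq)
  then have "convergent (\<lambda>N. weighted_shift (polar_weight ((neighbour_avg ^^ N) b) u))"
    using conv by (simp add: assms(2) aluthge_iterate_polar_weight[OF b u])
  moreover have "\<bar>(neighbour_avg ^^ N) b i\<bar> \<le> K" for N i
    by (rule neighbour_avg_funpow_abs_le) (rule b)
  ultimately have "\<exists>N0. \<forall>m\<ge>N0. \<forall>n\<ge>N0. \<forall>i.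
      \<bar>(neighbour_avg ^^ m) b i - (neighbour_avg ^^ n) b i\<bar> < e" if "e > 0" for e
    using that u by (intro weights_uniformly_Cauchy[where u = u])
  then obtain l where l: "\<And>e. e > 0 \<Longrightarrow> \<exists>N. \<forall>i. \<bar>(neighbour_avg ^^ N) b i - l\<bar> \<le> e"
    by (rule neighbour_avg_uniform_limit_const) blast+
  \<comment> \<open>The logarithms of the coordinates of any eigenvector satisfy the difference
    equation with \<open>c = ln (cmod z)\<close>, so every nonzero eigenvalue determines the same
    \<open>l\<close>.\<close>
  have l_eq: "l = ln (cmod z)" if "z \<noteq> 0" "x \<noteq> 0" "T x = z *\<^sub>C x" for z x
    using weighted_shift_eigenvector_ln[OF assms(1) nz that(1,2) that(3)[unfolded assms(2)]]
    by (intro neighbour_avg_uniform_limit_eq[OF _ _ l]) (simp_all add: b_def)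
  obtain R x y where R: "R > 1" and x: "x \<noteq> 0" "T x = x"
    and y: "y \<noteq> 0" "T y = complex_of_real R *\<^sub>C y"
    using shifted_hyperbolic_eigenvectors[OF assms(3)] by metis
  have "l = 0"
    using l_eq[of 1 x] x by simp
  moreover have "l = ln R"
    using l_eq[OF _ y] R by simp
  ultimately show False
    using R by simp
qed

end
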